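(* Let $k\ge 1$ be an integer, $N=2^k$, and consider the $(k+2,k)$ storage code over $\mathbb{F}=\mathbb{GF}(3)$ for files $\mathbf f=[\mathbf f_1^T\ \ldots\ \mathbf f_k^T]^T\in\mathbb{F}^{kN}$ (each $\mathbf f_i\in\mathbb{F}^N$), in which systematic node $i\in\{1,\ldots,k\}$ stores $\mathbf f_i$, parity node $a$ stores $\sum_{i=1}^k \mathbf A_i^T\mathbf f_i$ and parity node $b$ stores $\sum_{i=1}^k \mathbf B_i^T\mathbf f_i$, with $$\mathbf A_i=\mathbf I_N,\qquad \mathbf B_i=\mathbf X_i:=\mathbf I_{2^{i-1}}\otimes \mathrm{blkdiag}\left(\mathbf I_{N/2^i},-\mathbf I_{N/2^i}\right),\qquad i\in\{1,\ldots,k\}.$$ Then: 1. Every systematic node is optimally repairable: for each $i\in\{1,\ldots,k\}$, the minimum of the repair bandwidth $\gamma_i$ over all admissible pairs of repair matrices for node $i$ is attained and equals $(k+1)\frac N2$. 2. Each of the two parity nodes $a$ and $b$ can be exactly repaired from the remaining $k+1$ nodes with repair bandwidth at most that of a systematic repair, i.e., at most $(k+1)\frac N2$. 3. The code tolerates the failure of any single node, and of any pair of nodes that contains at most one systematic node. 4. At most $k+\frac12$ coded blocks are required to reconstruct the file: for any set $S$ of $k$ of the $k+2$ nodes, the contents of the nodes in $S$ (that is, $kN$ symbols) together with at most $\frac N2$ suitably chosen additional symbols stored at the nodes outside $S$ determine $\mathbf f$.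
   Context: All operations are over the field $\mathbb{F}=\mathbb{GF}(3)$; $\otimes$ is the Kronecker product, $\mathrm{blkdiag}$ denotes a block diagonal matrix, and $[\mathbf P\ \mathbf Q]$ denotes horizontal concatenation. Each node stores one coded block, i.e., a vector of $N$ symbols. Repair of a systematic node $i$. A pair of repair matrices $\mathbf V_i^{(a)},\mathbf V_i^{(b)}\in\mathbb{F}^{N\times N/2}$ is admissible for node $i$ if $\mathrm{rank}\left([\mathbf A_i\mathbf V_i^{(a)}\ \ \mathbf B_i\mathbf V_i^{(b)}]\right)=N$. (The newcomer downloads from each parity node its content multiplied on the left by the transpose of the corresponding repair matrix, and removes the interference of each $\mathbf f_j$, $j\neq i$, by downloading from systematic node $j$ a basis of the corresponding interference equations.) The repair bandwidth of an admissible pair is $$\gamma_i=N+\sum_{j=1,\,j\ne i}^k\mathrm{rank}\left(\left[\mathbf A_j\mathbf V_i^{(a)}\ \ \mathbf B_j\mathbf V_i^{(b)}\right]\right).$$ Repair of a parity node. A (linear) exact repair of a failed node consists of downloading, from each surviving node, some number of $\mathbb{F}$-linear functionals of that node's content (the functionals being fixed, independent of $\mathbf f$), such that the content of the failed node is determined by the downloaded values for every file $\mathbf f$; its repair bandwidth is the total number of functionals downloaded. Failure tolerance. The code tolerates the failure of a set of nodes $F$ if the contents of the nodes not in $F$ determine $\mathbf f$ (equivalently, the contents of all nodes). *)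

theory Defs
  imports "Jordan_Normal_Form.DL_Rank" "HOL-Library.FuncSet"
begin

definition kronecker :: "'a::semiring_0 mat \<Rightarrow> 'a mat \<Rightarrow> 'a mat" (infixl "\<otimes>\<^sub>K" 70) where
  "P \<otimes>\<^sub>K Q = mat (dim_row P * dim_row Q) (dim_col P * dim_col Q)
     (\<lambda>(r, c). P $$ (r div dim_row Q, c div dim_col Q) * Q $$ (r mod dim_row Q, c mod dim_col Q))"

definition hconcat :: "'a mat \<Rightarrow> 'a mat \<Rightarrow> 'a mat" where
  "hconcat P Q = mat_of_cols (dim_row P) (cols P @ cols Q)"

definition A_mat :: "nat \<Rightarrow> nat \<Rightarrow> 'a::field mat" where
  "A_mat k i = 1\<^sub>m (2 ^ k)"

definition X_mat :: "nat \<Rightarrow> nat \<Rightarrow> 'a::field mat" where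
  "X_mat k i = 1\<^sub>m (2 ^ (i - 1)) \<otimes>\<^sub>K
     diag_block_mat [1\<^sub>m (2 ^ k div 2 ^ i), - 1\<^sub>m (2 ^ k div 2 ^ i)]"

definition B_mat :: "nat \<Rightarrow> nat \<Rightarrow> 'a::field mat" where
  "B_mat k i = X_mat k i"

datatype node = Sys nat | Par_a | Par_b

definition systematic :: "nat \<Rightarrow> node set" where
  "systematic k = Sys ` {1..k}"

definition nodes :: "nat \<Rightarrow> node set" where
  "nodes k = systematic k \<union> {Par_a, Par_b}"

definition files :: "'a::field itself \<Rightarrow> nat \<Rightarrow> 'a vec set" where
  "files _ k = carrier_vec (k * 2 ^ k)"

text \<open>File parts are numbered from 1, vector entries from 0.\<close>

definition file_part :: "nat \<Rightarrow> 'a vec \<Rightarrow> nat \<Rightarrow> 'a vec" where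
  "file_part k f i = vec (2 ^ k) (\<lambda>r. f $ ((i - 1) * 2 ^ k + r))"

fun node_content :: "nat \<Rightarrow> 'a::field vec \<Rightarrow> node \<Rightarrow> 'a vec" where
  "node_content k f (Sys i) = file_part k f i"
| "node_content k f Par_a =
     finsum_vec TYPE('a) (2 ^ k) (\<lambda>i. transpose_mat (A_mat k i) *\<^sub>v file_part k f i) {1..k}"
| "node_content k f Par_b =
     finsum_vec TYPE('a) (2 ^ k) (\<lambda>i. transpose_mat (B_mat k i) *\<^sub>v file_part k f i) {1..k}"

text \<open>The data \<open>obs f\<close> determine \<open>tgt f\<close>, for \<open>f\<close> ranging over all files.\<close>

definition determines :: "nat \<Rightarrow> ('a::field vec \<Rightarrow> 'b) \<Rightarrow> ('a vec \<Rightarrow> 'c) \<Rightarrow> bool" where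
  "determines k obs tgt \<longleftrightarrow>
     (\<forall>f \<in> files TYPE('a) k. \<forall>g \<in> files TYPE('a) k. obs f = obs g \<longrightarrow> tgt f = tgt g)"

definition admissible :: "nat \<Rightarrow> nat \<Rightarrow> 'a::field mat \<Rightarrow> 'a mat \<Rightarrow> bool" where
  "admissible k i Va Vb \<longleftrightarrow>
     Va \<in> carrier_mat (2 ^ k) (2 ^ k div 2) \<and> Vb \<in> carrier_mat (2 ^ k) (2 ^ k div 2) \<and>
     vec_space.rank (2 ^ k) (hconcat (A_mat k i * Va) (B_mat k i * Vb)) = 2 ^ k"

definition sys_bandwidth :: "nat \<Rightarrow> nat \<Rightarrow> 'a::field mat \<Rightarrow> 'a mat \<Rightarrow> nat" where
  "sys_bandwidth k i Va Vb =
     2 ^ k + (\<Sum>j \<in> {1..k} - {i}. vec_space.rank (2 ^ k) (hconcat (A_mat k j * Va) (B_mat k j * Vb)))"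

text \<open>The rows of \<open>D n\<close> are the linear functionals downloaded from node \<open>n\<close>.\<close>

definition exact_repair :: "nat \<Rightarrow> node \<Rightarrow> (node \<Rightarrow> 'a::field mat) \<Rightarrow> bool" where
  "exact_repair k x D \<longleftrightarrow>
     (\<forall>n \<in> nodes k - {x}. dim_col (D n) = 2 ^ k) \<and>
     determines k (\<lambda>f. \<lambda>n \<in> nodes k - {x}. D n *\<^sub>v node_content k f n) (\<lambda>f. node_content k f x)"

definition repair_bandwidth :: "nat \<Rightarrow> node \<Rightarrow> (node \<Rightarrow> 'a mat) \<Rightarrow> nat" where
  "repair_bandwidth k x D = (\<Sum>n \<in> nodes k - {x}. dim_row (D n))"

definition tolerates :: "'a::field itself \<Rightarrow> nat \<Rightarrow> node set \<Rightarrow> bool" where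
  "tolerates _ k F \<longleftrightarrow>
     determines k (\<lambda>f :: 'a vec. \<lambda>n \<in> nodes k - F. node_content k f n) (\<lambda>f. f)"

end

theory Submission
  imports Defs
begin

text \<open>Number the entries of a file part by \<open>r < 2\<^sup>k\<close>. Then \<open>X\<^sub>i\<close> is diagonal, with sign at \<open>r\<close> given by the
  binary digit \<open>k - i\<close> of \<open>r\<close>, so the code decouples over \<open>r\<close>, and two distinct \<open>X\<^sub>i\<close>, \<open>X\<^sub>j\<close> agree at exactly
  half of the \<open>r\<close>. This yields the parity repair and the reconstruction. A systematic node is
  repaired along the sums of unit vectors whose indices differ in the digit \<open>k - i\<close>; optimality holds
  because admissibility forces the first repair matrix to have full column rank.\<close>

section \<open>Counting indices by their binary digits\<close>

lemma flip_bit_less_power: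
  fixes r :: nat
  assumes "p < k" "r < 2 ^ k"
  shows "flip_bit p r < 2 ^ k"
proof -
  have "take_bit k (flip_bit p r) = flip_bit p r"
    using assms by (simp add: take_bit_flip_bit_eq take_bit_nat_eq_self)
  then show ?thesis
    by (metis take_bit_nat_less_exp)
qed

lemma flip_bit_flip_bit:
  fixes r :: nat
  shows "flip_bit p (flip_bit p r) = r"
  by (rule bit_eqI) (auto simp: bit_simps)

lemma flip_bit_neq:
  fixes r :: nat
  shows "flip_bit p r \<noteq> r"
proof
  assume "flip_bit p r = r"
  then have "bit (flip_bit p r) p = bit r p"
    by simp
  then show False
    by (simp add: bit_simps)
qed

text \<open>Flipping digit \<open>p\<close> is an involution on the indices below
  \<open>2 ^ k\<close> that exchanges those with \<open>P\<close> and those without, so the two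
  classes have equal size.\<close>

lemma card_half_flip_bit:
  assumes "p < k" and flip: "\<And>r :: nat. r < 2 ^ k \<Longrightarrow> P (flip_bit p r) \<longleftrightarrow> \<not> P r"
  shows "card {r. r < 2 ^ k \<and> P r} = 2 ^ k div 2"
proof -
  let ?Y = "{r. r < 2 ^ k \<and> P r}" and ?N = "{r. r < 2 ^ k \<and> \<not> P r}"
  have "bij_betw (flip_bit p) ?Y ?N"
    by (rule bij_betwI[where g = "flip_bit p"])
      (use assms in \<open>auto simp: flip_bit_flip_bit flip_bit_less_power\<close>)
  then have eq: "card ?Y = card ?N"
    by (rule bij_betw_same_card)
  have "?Y \<union> ?N = {..<2 ^ k}" "?Y \<inter> ?N = {}"
    by auto
  then have "card ?Y + card ?N = 2 ^ k"
    by (metis (no_types, lifting) card_Un_disjoint card_lessThan finite_Un finite_lessThan)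
  with eq show ?thesis
    by simp
qed

lemma card_bit_clear:
  assumes "p < k"
  shows "card {r :: nat. r < 2 ^ k \<and> \<not> bit r p} = 2 ^ k div 2"
  by (rule card_half_flip_bit[OF assms]) (auto simp: bit_simps)

lemma card_bit_agree:
  assumes "p < k" "p \<noteq> q"
  shows "card {r :: nat. r < 2 ^ k \<and> bit r p = bit r q} = 2 ^ k div 2"
  by (rule card_half_flip_bit[OF assms(1)]) (use assms in \<open>auto simp: bit_simps\<close>)

lemma card_bit_differ:
  assumes "p < k" "p \<noteq> q"
  shows "card {r :: nat. r < 2 ^ k \<and> bit r p \<noteq> bit r q} = 2 ^ k div 2"
  by (rule card_half_flip_bit[OF assms(1)]) (use assms in \<open>auto simp: bit_simps\<close>)


section \<open>The coding matrices as diagonal matrices\<close>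

text \<open>The blocks of equal sign in \<open>X\<^sub>i\<close> have length
  \<open>2 ^ (k - i)\<close>, hence the digit \<open>k - i\<close>: the most significant one for
  \<open>i = 1\<close>, the last one for \<open>i = k\<close>.\<close>

definition diag_sign :: "nat \<Rightarrow> nat \<Rightarrow> nat \<Rightarrow> 'a::field" where
  "diag_sign k i r = (if bit r (k - i) then - 1 else 1)"

lemma diag_sign_square [simp]: "diag_sign k i r * diag_sign k i r = 1"
  by (simp add: diag_sign_def)

text \<open>In characteristic 2 any \<open>x\<close> other than 0 and 1 would yield four distinct
  elements 0, 1, \<open>x\<close>, \<open>1 + x\<close>. The size of the field enters the proof
  through this inequality.\<close>

lemma card_3_one_neq_minus_one:
  assumes "card (UNIV :: 'a::field set) = 3"
  shows "(1 :: 'a) \<noteq> - 1"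
proof
  assume "(1 :: 'a) = - 1"
  then have two: "(1 :: 'a) + 1 = 0"
    by (metis add.right_inverse)
  have fin: "finite (UNIV :: 'a set)"
    using assms card.infinite by fastforce
  have "card {0, 1 :: 'a} = 2"
    by simp
  then have "{0, 1 :: 'a} \<noteq> UNIV"
    using assms by (metis numeral_eq_iff semiring_norm(89))
  then obtain x :: 'a where x: "x \<noteq> 0" "x \<noteq> 1"
    by auto
  have "1 + x \<noteq> 0"
    using x two by (metis add_left_cancel)
  then have "card {0, 1, x, 1 + x} = 4"
    using x by auto
  then show False
    using card_mono[OF fin, of "{0, 1, x, 1 + x}"] assms by simp
qed

lemma double_eq_0_imp_eq_0:
  assumes "(1 :: 'a::field) \<noteq> - 1" "x + x = (0 :: 'a)"
  shows "x = 0"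
proof -
  have "(1 + 1) * x = 0"
    unfolding distrib_right using assms(2) by (simp only: mult_1_left)
  moreover have "1 + 1 \<noteq> (0 :: 'a)"
    using assms(1) by (metis add_eq_0_iff)
  ultimately show ?thesis
    by (metis mult_eq_0_iff)
qed

lemma X_mat_eq_mat_diag:
  assumes "i \<in> {1..k}"
  shows "X_mat k i = (mat_diag (2 ^ k) (diag_sign k i) :: 'a::field mat)"
proof -
  define m :: nat where "m = 2 ^ (k - i)"
  have m: "2 ^ k div 2 ^ i = m" "m > 0"
    unfolding m_def using assms by (simp_all add: power_diff[symmetric])
  have "(2 :: nat) ^ (i - 1) * (m + m) = 2 ^ (i - 1) * 2 * 2 ^ (k - i)"
    by (simp add: m_def)
  also have "\<dots> = 2 ^ (Suc (i - 1) + (k - i))"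
    by (simp only: power_add power_Suc2)
  also have "Suc (i - 1) + (k - i) = k"
    using assms by auto
  finally have dim: "(2 :: nat) ^ (i - 1) * (m + m) = 2 ^ k" .
  \<comment> \<open>The position of \<open>r\<close> within its block of length \<open>2 * m\<close>
    lies in the first half iff \<open>r div m\<close> is even, and the parity of
    \<open>r div m\<close> is the digit \<open>k - i\<close>.\<close>
  have sign: "r mod (m + m) < m \<longleftrightarrow> \<not> bit r (k - i)" for r
  proof -
    have "r mod (2 * m) = m * (r div m mod 2) + r mod m"
      using mod_mult2_eq[of r m 2] by (simp add: mult.commute)
    moreover have "r mod m < m"
      using m by simp
    ultimately show ?thesis
      by (cases "even (r div m)")
        (auto simp: bit_iff_odd m_def[symmetric] mult_2[symmetric] even_iff_mod_2_eq_zero odd_iff_mod_2_eq_one)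
  qed
  \<comment> \<open>Off the diagonal, either the block numbers differ and the identity factor
    vanishes, or the positions within the block differ and the block entry vanishes.\<close>
  have same: "r = c \<longleftrightarrow> r div (m + m) = c div (m + m) \<and> r mod (m + m) = c mod (m + m)" for r c
    by (metis div_mult_mod_eq)
  have block: "(diag_block_mat [1\<^sub>m m, - 1\<^sub>m m] :: 'a mat) $$ (r mod (m + m), c mod (m + m)) =
      (if r mod (m + m) = c mod (m + m) then diag_sign k i r else 0)" for r c
  proof -
    have entry: "(diag_block_mat [1\<^sub>m m, - 1\<^sub>m m] :: 'a mat) $$ (x, y) =
        (if x = y then if x < m then 1 else - 1 else 0)" if "x < m + m" "y < m + m" for x y
      using that by (auto simp: Let_def)
    have "x mod (m + m) < m + m" for x
      using m by simp
    from entry[OF this[of r] this[of c]] show ?thesis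
      unfolding sign by (simp add: diag_sign_def del: diag_block_mat.simps)
  qed
  have dims: "dim_row (diag_block_mat [1\<^sub>m m, - 1\<^sub>m m] :: 'a mat) = m + m"
    "dim_col (diag_block_mat [1\<^sub>m m, - 1\<^sub>m m] :: 'a mat) = m + m"
    by (simp_all add: Let_def)
  show ?thesis
  proof (rule eq_matI)
    fix r c
    assume rc: "r < dim_row (mat_diag (2 ^ k) (diag_sign k i) :: 'a mat)"
      "c < dim_col (mat_diag (2 ^ k) (diag_sign k i) :: 'a mat)"
    then have rc: "r < 2 ^ k" "c < 2 ^ k"
      by (simp_all add: mat_diag_def)
    have quot: "r div (m + m) < 2 ^ (i - 1)" "c div (m + m) < 2 ^ (i - 1)"
      using rc dim by (metis less_mult_imp_div_less mult.commute)+
    show "X_mat k i $$ (r, c) = (mat_diag (2 ^ k) (diag_sign k i) :: 'a mat) $$ (r, c)"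
      unfolding X_mat_def kronecker_def m(1) dims index_one_mat(2,3) dim mat_diag_def
      using rc quot same[of r c] by (cases "r = c") (auto simp: block simp del: diag_block_mat.simps)
  qed (unfold X_mat_def kronecker_def m(1) dims index_one_mat(2,3) dim mat_diag_def, simp_all)
qed

lemma mat_diag_mult_vec:
  assumes "v \<in> carrier_vec n"
  shows "mat_diag n d *\<^sub>v v = vec n (\<lambda>r. d r * (v $ r :: 'a::semiring_0))"
proof (rule eq_vecI)
  fix r
  assume "r < dim_vec (vec n (\<lambda>r. d r * v $ r))"
  then have r: "r < n"
    by simp
  have "(mat_diag n d *\<^sub>v v) $ r = (\<Sum>c\<in>{0..<n}. (if r = c then d c else 0) * v $ c)"
    using r assms by (simp add: mat_diag_def scalar_prod_def)
  also have "\<dots> = (\<Sum>c\<in>{0..<n}. if r = c then d c * v $ c else 0)"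
    by (rule sum.cong) auto
  finally show "(mat_diag n d *\<^sub>v v) $ r = vec n (\<lambda>r. d r * v $ r) $ r"
    using r by simp
qed (simp add: mat_diag_def)

lemma transpose_mat_diag: "transpose_mat (mat_diag n d) = mat_diag n d"
  by (rule eq_matI) (auto simp: mat_diag_def)


section \<open>Ranks of concatenated matrices\<close>

lemma set_cols_mult:
  assumes "P \<in> carrier_mat l n" "Q \<in> carrier_mat n m"
  shows "set (cols (P * Q)) = (*\<^sub>v) P ` set (cols Q)"
  using assms by (auto simp: cols_def image_image intro!: image_cong)

lemma cols_hconcat:
  assumes "P \<in> carrier_mat n a" "Q \<in> carrier_mat n b"
  shows "cols (hconcat P Q) = cols P @ cols Q"
proof -
  have "set (cols P @ cols Q) \<subseteq> carrier_vec n"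
    using assms cols_dim[of P] cols_dim[of Q] by auto
  then show ?thesis
    using assms by (simp add: hconcat_def)
qed

lemma hconcat_carrier:
  assumes "P \<in> carrier_mat n a" "Q \<in> carrier_mat n b"
  shows "hconcat P Q \<in> carrier_mat n (a + b)"
  using assms by (auto simp: hconcat_def)

text \<open>A maximal independent set of columns has as many elements as the rank, and it lies in a
  space of dimension at most \<open>card T\<close>.\<close>

lemma (in vec_space) rank_le_card_span:
  assumes M: "M \<in> carrier_mat n nc" and T: "finite T" "T \<subseteq> carrier_vec n"
    and sub: "set (cols M) \<subseteq> span T"
  shows "rank M \<le> card T"
proof -
  obtain S where S: "maximal S (\<lambda>S. S \<subseteq> set (cols M) \<and> lin_indpt S)"
    using maximal_exists_superset[of "set (cols M)" "\<lambda>S. S \<subseteq> set (cols M) \<and> lin_indpt S" "{}"]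
    by (metis List.finite_set empty_subsetI finite_lin_indpt2 empty_iff finite.emptyI)
  then have S_sub: "S \<subseteq> span T" and S_li: "lin_indpt S"
    using sub by (auto simp: maximal_def)
  have sm: "submodule class_ring (span T) V"
    using T by (simp add: span_is_submodule)
  \<comment> \<open>The dimension bounds are applied inside the span of \<open>T\<close>, taken as a
    vector space of its own; spanning and independence carry over from the ambient space.\<close>
  interpret W: vectorspace class_ring "span_vs T"
    using T by (simp add: span_is_subspace subspace_is_vs)
  have T_own: "T \<subseteq> span T"
    using T by (simp add: in_own_span)
  have gen: "W.gen_set T"
    using span_li_not_depend(1)[OF T_own sm] by simp
  have "W.fin_dim"
    using fin_dim_span[of T] T by simp
  moreover have "W.lin_indpt S"
    using span_li_not_depend(2)[OF S_sub sm] S_li by simp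
  ultimately have "card S \<le> W.dim"
    using W.li_le_dim(2)[of S] S_sub by simp
  also have "\<dots> \<le> card T"
    using W.gen_ge_dim[of T] T T_own gen by simp
  finally show ?thesis
    using rank_card_indpt[OF M S] by simp
qed

text \<open>Full rank makes all columns of the square matrix independent, in particular those of
  \<open>P\<close>, and these are still present when \<open>Q\<close> is exchanged for
  \<open>R\<close>. This is the source of the lower bound on the repair bandwidth.\<close>

lemma (in vec_space) full_rank_hconcat_left:
  assumes P: "P \<in> carrier_mat n a" and Q: "Q \<in> carrier_mat n b" and R: "R \<in> carrier_mat n c"
    and "a + b = n" and full: "rank (hconcat P Q) = n"
  shows "a \<le> rank (hconcat P R)"
proof -
  have PQ: "hconcat P Q \<in> carrier_mat n n"
    using hconcat_carrier[OF P Q] assms(4) by simp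
  \<comment> \<open>Independence concerns the set of columns, so repetitions must be excluded before
    the columns of \<open>P\<close> can be counted.\<close>
  have dist: "distinct (cols (hconcat P Q))"
    using non_distinct_low_rank[OF PQ] full by auto
  then have "lin_indpt (set (cols (hconcat P Q)))"
    using full_rank_lin_indpt[OF PQ] full by simp
  then have "lin_indpt (set (cols P))"
    by (rule subset_li_is_li) (simp add: cols_hconcat[OF P Q])
  moreover have "card (set (cols P)) = a"
    using dist P by (simp add: cols_hconcat[OF P Q] distinct_card)
  ultimately show ?thesis
    using rank_ge_card_indpt[OF hconcat_carrier[OF P R], of "set (cols P)"]
    by (simp add: cols_hconcat[OF P R])
qed

text \<open>If only the zero vector is orthogonal to all columns, the transpose has trivial kernel
  and therefore nonzero determinant.\<close>

lemma (in vec_space) full_rankI: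
  assumes M: "M \<in> carrier_mat n n"
    and triv: "\<And>v. v \<in> carrier_vec n \<Longrightarrow> (\<And>w. w \<in> set (cols M) \<Longrightarrow> w \<bullet> v = 0) \<Longrightarrow> v = 0\<^sub>v n"
  shows "rank M = n"
proof -
  have "det (transpose_mat M) \<noteq> 0"
  proof
    assume "det (transpose_mat M) = 0"
    then obtain v where v: "v \<in> carrier_vec n" "v \<noteq> 0\<^sub>v n" "transpose_mat M *\<^sub>v v = 0\<^sub>v n"
      using det_0_iff_vec_prod_zero_field[of "transpose_mat M" n] M by auto
    have "w \<bullet> v = 0" if w: "w \<in> set (cols M)" for w
    proof -
      obtain j where j: "j < n" "w = col M j"
        using w M by (auto simp: cols_def)
      then have "w \<bullet> v = (transpose_mat M *\<^sub>v v) $ j"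
        using M by simp
      then show ?thesis
        using v j by simp
    qed
    with triv v show False
      by blast
  qed
  then show ?thesis
    using det_rank_iff[OF M] det_transpose[OF M] by simp
qed


section \<open>Repair of systematic nodes\<close>

text \<open>Each \<open>A_mat k j\<close> is the identity, so every one of the \<open>k - 1\<close>
  interference matrices contains the columns of \<open>Va\<close>. Admissibility makes these
  independent, and each rank is at least half of \<open>2 ^ k\<close>.\<close>

lemma sys_bandwidth_ge:
  assumes k: "k \<ge> 1" and i: "i \<in> {1..k}" and adm: "admissible k i Va (Vb :: 'a::field mat)"
  shows "(k + 1) * (2 ^ k div 2) \<le> sys_bandwidth k i Va Vb"
proof -
  let ?h = "(2 :: nat) ^ k div 2"
  \<comment> \<open>The division by 2 is exact because \<open>k\<close> is positive.\<close>
  have h: "?h + ?h = 2 ^ k"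
    using k by (cases k) auto
  have Va: "A_mat k j * Va \<in> carrier_mat (2 ^ k) ?h" and A_eq: "A_mat k j * Va = A_mat k i * Va" for j
    using adm by (auto simp: admissible_def A_mat_def)
  have Vb: "B_mat k j * Vb \<in> carrier_mat (2 ^ k) ?h" if "j \<in> {1..k}" for j
    using adm that by (auto simp: admissible_def B_mat_def X_mat_eq_mat_diag intro!: mult_carrier_mat)
  have rank: "?h \<le> vec_space.rank (2 ^ k) (hconcat (A_mat k j * Va) (B_mat k j * Vb))"
    if "j \<in> {1..k} - {i}" for j
    unfolding A_eq[of j]
    by (rule vec_space.full_rank_hconcat_left[OF Va Vb[OF i] Vb h])
      (use adm that in \<open>auto simp: admissible_def\<close>)
  have "(k + 1) * ?h = 2 ^ k + (k - 1) * ?h"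
    using h k by (cases k) auto
  also have "\<dots> = 2 ^ k + (\<Sum>j \<in> {1..k} - {i}. ?h)"
    using i by simp
  also have "\<dots> \<le> sys_bandwidth k i Va Vb"
    unfolding sys_bandwidth_def by (intro add_left_mono sum_mono rank)
  finally show ?thesis .
qed

text \<open>The clear digit selects one index from each pair exchanged by \<open>flip_bit p\<close>;
  sorting merely fixes an order of the future columns.\<close>

definition paired_units :: "nat \<Rightarrow> nat \<Rightarrow> 'a::field vec list" where
  "paired_units k p = map (\<lambda>c. unit_vec (2 ^ k) c + unit_vec (2 ^ k) (flip_bit p c))
     (sorted_list_of_set {c. c < 2 ^ k \<and> \<not> bit c p})"

lemma set_paired_units:
  "set (paired_units k p) =
     (\<lambda>c. unit_vec (2 ^ k) c + unit_vec (2 ^ k) (flip_bit p c)) ` {c. c < 2 ^ k \<and> \<not> bit c p}"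
  by (simp add: paired_units_def)

text \<open>The column space of this matrix is invariant under \<open>X\<^sub>j\<close> for \<open>j \<noteq> i\<close>, while \<open>X\<^sub>i\<close> maps it to a
  complement.\<close>

definition repair_mat :: "nat \<Rightarrow> nat \<Rightarrow> 'a::field mat" where
  "repair_mat k i = mat_of_cols (2 ^ k) (paired_units k (k - i))"

lemma repair_mat_carrier:
  assumes "i \<in> {1..k}"
  shows "repair_mat k i \<in> carrier_mat (2 ^ k) (2 ^ k div 2)"
proof -
  have "k - i < k"
    using assms by auto
  then show ?thesis
    using mat_of_cols_carrier(1)[of "2 ^ k" "paired_units k (k - i)"]
    by (simp add: repair_mat_def paired_units_def card_bit_clear)
qed

lemma cols_repair_mat:
  "cols (repair_mat k i) = (paired_units k (k - i) :: 'a::field vec list)"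
  unfolding repair_mat_def by (rule cols_mat_of_cols) (auto simp: set_paired_units)

text \<open>The two indices of a pair differ in the very digit that decides the sign of
  \<open>X\<^sub>i\<close>, and \<open>c\<close> is the one with sign 1; sums thus become
  differences.\<close>

lemma X_mat_repair_mat_same:
  assumes "i \<in> {1..k}"
  shows "set (cols (X_mat k i * repair_mat k i)) =
    (\<lambda>c. unit_vec (2 ^ k) c - unit_vec (2 ^ k) (flip_bit (k - i) c) :: 'a::field vec)
      ` {c. c < 2 ^ k \<and> \<not> bit c (k - i)}"
proof -
  have p: "k - i < k"
    using assms by auto
  have "mat_diag (2 ^ k) (diag_sign k i) *\<^sub>v (unit_vec (2 ^ k) c + unit_vec (2 ^ k) (flip_bit (k - i) c)) =
      (unit_vec (2 ^ k) c - unit_vec (2 ^ k) (flip_bit (k - i) c) :: 'a vec)"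
    if "c < 2 ^ k" "\<not> bit c (k - i)" for c
    using that flip_bit_neq[of "k - i" c] flip_bit_less_power[OF p that(1)]
    by (subst mat_diag_mult_vec) (auto simp: diag_sign_def bit_simps intro!: eq_vecI)
  then show ?thesis
    unfolding X_mat_eq_mat_diag[OF assms] set_cols_mult[OF mat_diag_dim repair_mat_carrier[OF assms]]
      cols_repair_mat set_paired_units image_image
    by (intro image_cong) auto
qed

text \<open>Flipping digit \<open>k - i\<close> leaves digit \<open>k - j\<close> unchanged, so both
  indices of a pair carry the same sign of \<open>X\<^sub>j\<close> and each column is only
  scaled.\<close>

lemma X_mat_repair_mat_other:
  assumes i: "i \<in> {1..k}" and j: "j \<in> {1..k}" "j \<noteq> i"
  shows "set (cols (X_mat k j * repair_mat k i)) =
    (\<lambda>c. diag_sign k j c \<cdot>\<^sub>v (unit_vec (2 ^ k) c + unit_vec (2 ^ k) (flip_bit (k - i) c) :: 'a::field vec))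
      ` {c. c < 2 ^ k \<and> \<not> bit c (k - i)}"
proof -
  have p: "k - i < k" "k - j \<noteq> k - i"
    using i j by auto
  have "mat_diag (2 ^ k) (diag_sign k j) *\<^sub>v (unit_vec (2 ^ k) c + unit_vec (2 ^ k) (flip_bit (k - i) c)) =
      diag_sign k j c \<cdot>\<^sub>v (unit_vec (2 ^ k) c + unit_vec (2 ^ k) (flip_bit (k - i) c) :: 'a vec)"
    if "c < 2 ^ k" for c
    using that flip_bit_less_power[OF p(1) that] p(2)
    by (subst mat_diag_mult_vec) (auto simp: diag_sign_def bit_simps intro!: eq_vecI)
  then show ?thesis
    unfolding X_mat_eq_mat_diag[OF j(1)] set_cols_mult[OF mat_diag_dim repair_mat_carrier[OF i]]
      cols_repair_mat set_paired_units image_image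
    by (intro image_cong) auto
qed

text \<open>A vector orthogonal to both the sum and the difference of two unit vectors vanishes at
  both indices, since 2 is invertible; the pairs exhaust all indices.\<close>

lemma admissible_repair_mat:
  assumes char: "(1 :: 'a::field) \<noteq> - 1" and k: "k \<ge> 1" and i: "i \<in> {1..k}"
  shows "admissible k i (repair_mat k i) (repair_mat k i :: 'a mat)"
proof -
  let ?V = "repair_mat k i :: 'a mat" and ?N = "2 ^ k :: nat" and ?p = "k - i"
  have p: "?p < k"
    using i by auto
  have h: "?N div 2 + ?N div 2 = ?N"
    using k by (cases k) auto
  have V: "?V \<in> carrier_mat ?N (?N div 2)"
    by (rule repair_mat_carrier[OF i])
  have XV: "X_mat k i * ?V \<in> carrier_mat ?N (?N div 2)"
    unfolding X_mat_eq_mat_diag[OF i] by (rule mult_carrier_mat[OF mat_diag_dim V])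
  have M: "hconcat ?V (X_mat k i * ?V) \<in> carrier_mat ?N ?N"
    using hconcat_carrier[OF V XV] h by simp
  have "vec_space.rank ?N (hconcat ?V (X_mat k i * ?V)) = ?N"
  proof (rule vec_space.full_rankI[OF M])
    fix v :: "'a vec"
    assume v: "v \<in> carrier_vec ?N"
      and orth: "\<And>w. w \<in> set (cols (hconcat ?V (X_mat k i * ?V))) \<Longrightarrow> w \<bullet> v = 0"
    have pair: "v $ c = 0 \<and> v $ flip_bit ?p c = 0" if c: "c < ?N" "\<not> bit c ?p" for c
    proof -
      have f: "flip_bit ?p c < ?N"
        using flip_bit_less_power[OF p] c by simp
      have "(unit_vec ?N c + unit_vec ?N (flip_bit ?p c)) \<bullet> v = 0"
        "(unit_vec ?N c - unit_vec ?N (flip_bit ?p c)) \<bullet> v = 0"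
        using c by (auto intro!: orth
          simp: cols_hconcat[OF V XV] cols_repair_mat set_paired_units X_mat_repair_mat_same[OF i])
      then have "v $ c + v $ flip_bit ?p c = 0" "v $ c - v $ flip_bit ?p c = 0"
        using v c f
        by (simp_all add: add_scalar_prod_distrib[of _ ?N] minus_scalar_prod_distrib[of _ ?N])
      then have "v $ c = v $ flip_bit ?p c" "v $ c + v $ c = 0"
        by (metis eq_iff_diff_eq_0)+
      then show ?thesis
        using double_eq_0_imp_eq_0[OF char] by metis
    qed
    \<comment> \<open>An index with the digit set is the partner of its flip, which has the digit
      clear.\<close>
    have "v $ r = 0" if r: "r < ?N" for r
    proof (cases "bit r ?p")
      case True
      then have "\<not> bit (flip_bit ?p r) ?p"
        by (simp add: bit_simps)
      then show ?thesis
        using pair[OF flip_bit_less_power[OF p r]] by (simp add: flip_bit_flip_bit)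
    qed (use pair r in simp)
    then show "v = 0\<^sub>v ?N"
      using v by (intro eq_vecI) auto
  qed
  moreover have "A_mat k i * ?V = ?V"
    using V by (simp add: A_mat_def)
  ultimately show ?thesis
    using V by (simp add: admissible_def B_mat_def)
qed

text \<open>For \<open>j\<close> other than \<open>i\<close> the interference stays in the column
  space of \<open>repair_mat k i\<close>, which is spanned by half of \<open>2 ^ k\<close>
  columns.\<close>

lemma sys_bandwidth_repair_mat_le:
  assumes k: "k \<ge> 1" and i: "i \<in> {1..k}"
  shows "sys_bandwidth k i (repair_mat k i) (repair_mat k i :: 'a::field mat) \<le> (k + 1) * (2 ^ k div 2)"
proof -
  let ?V = "repair_mat k i :: 'a mat" and ?h = "(2 :: nat) ^ k div 2"
  have h: "?h + ?h = 2 ^ k"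
    using k by (cases k) auto
  have V: "?V \<in> carrier_mat (2 ^ k) ?h"
    by (rule repair_mat_carrier[OF i])
  have rank: "vec_space.rank (2 ^ k) (hconcat (A_mat k j * ?V) (B_mat k j * ?V)) \<le> ?h"
    if j: "j \<in> {1..k} - {i}" for j
  proof -
    interpret vec_space "TYPE('a)" "2 ^ k" .
    have XV: "X_mat k j * ?V \<in> carrier_mat (2 ^ k) ?h"
      using j by (auto simp: X_mat_eq_mat_diag intro!: mult_carrier_mat[OF mat_diag_dim V])
    have sub: "set (cols ?V) \<subseteq> carrier_vec (2 ^ k)"
      using cols_dim[of ?V] V by simp
    then have own: "set (cols ?V) \<subseteq> span (set (cols ?V))"
      by (simp add: in_own_span)
    then have "set (cols (X_mat k j * ?V)) \<subseteq> span (set (cols ?V))"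
      using j unfolding cols_repair_mat set_paired_units
      by (subst X_mat_repair_mat_other[OF i])
        (auto intro!: smult_in_span[OF sub[unfolded cols_repair_mat set_paired_units]])
    then have "rank (hconcat ?V (X_mat k j * ?V)) \<le> card (set (cols ?V))"
      using own sub
      by (intro rank_le_card_span[OF hconcat_carrier[OF V XV]]) (auto simp: cols_hconcat[OF V XV])
    also have "\<dots> \<le> ?h"
      using card_length[of "cols ?V"] V by simp
    finally show ?thesis
      using V by (simp add: A_mat_def B_mat_def)
  qed
  have "sys_bandwidth k i ?V ?V \<le> 2 ^ k + (\<Sum>j \<in> {1..k} - {i}. ?h)"
    unfolding sys_bandwidth_def by (intro add_left_mono sum_mono rank)
  also have "\<dots> = 2 ^ k + (k - 1) * ?h"
    using i by simp
  also have "\<dots> = (k + 1) * ?h"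
    using h k by (cases k) auto
  finally show ?thesis .
qed


section \<open>Node contents\<close>

lemma file_part_carrier [simp]: "file_part k f i \<in> carrier_vec (2 ^ k)"
  by (simp add: file_part_def)

lemma node_content_Par_a_index:
  assumes "r < 2 ^ k"
  shows "node_content k f Par_a $ r = (\<Sum>i\<in>{1..k}. file_part k (f :: 'a::field vec) i $ r)"
proof -
  have "transpose_mat (A_mat k i) *\<^sub>v file_part k f i = file_part k f i" for i
    by (simp add: A_mat_def)
  then show ?thesis
    using assms by (simp add: index_finsum_vec)
qed

text \<open>The matrices are diagonal, so entry \<open>r\<close> of a parity involves only the
  entries \<open>r\<close> of the file parts; later arguments can fix one \<open>r\<close>.\<close>

lemma node_content_Par_b_index:
  assumes "r < 2 ^ k"
  shows "node_content k f Par_b $ r =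
    (\<Sum>i\<in>{1..k}. diag_sign k i r * file_part k (f :: 'a::field vec) i $ r)"
proof -
  have eq: "transpose_mat (B_mat k i) *\<^sub>v file_part k f i =
      vec (2 ^ k) (\<lambda>r. diag_sign k i r * file_part k f i $ r)" if "i \<in> {1..k}" for i
    by (simp add: B_mat_def X_mat_eq_mat_diag[OF that] transpose_mat_diag mat_diag_mult_vec)
  have "node_content k f Par_b $ r = (\<Sum>i\<in>{1..k}. (transpose_mat (B_mat k i) *\<^sub>v file_part k f i) $ r)"
    unfolding node_content.simps by (rule index_finsum_vec) (use assms eq in auto)
  then show ?thesis
    using assms by (simp add: eq)
qed

lemma node_content_carrier: "node_content k (f :: 'a::field vec) n \<in> carrier_vec (2 ^ k)"
proof (cases n)
  case Par_a
  then show ?thesis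
    by (auto simp: A_mat_def intro!: finsum_vec_closed)
next
  case Par_b
  have "transpose_mat (B_mat k i) *\<^sub>v file_part k f i \<in> carrier_vec (2 ^ k)" if "i \<in> {1..k}" for i
    by (simp add: B_mat_def X_mat_eq_mat_diag[OF that] transpose_mat_diag mat_diag_mult_vec)
  then show ?thesis
    using Par_b by (auto intro!: finsum_vec_closed)
qed simp

lemma file_eqI:
  assumes f: "f \<in> files TYPE('a::field) k" and g: "g \<in> files TYPE('a) k"
    and parts: "\<And>i r. i \<in> {1..k} \<Longrightarrow> r < 2 ^ k \<Longrightarrow> file_part k f i $ r = file_part k g i $ r"
  shows "f = g"
proof (rule eq_vecI)
  fix s
  assume "s < dim_vec g"
  then have s: "s < k * 2 ^ k"
    using g by (simp add: files_def)
  then have "s div 2 ^ k < k"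
    by (simp add: less_mult_imp_div_less)
  \<comment> \<open>File parts are numbered from 1, hence the successor.\<close>
  then have "Suc (s div 2 ^ k) \<in> {1..k}" "s mod 2 ^ k < 2 ^ k"
    by auto
  from parts[OF this] show "f $ s = g $ s"
    by (simp add: file_part_def div_mult_mod_eq)
qed (use f g in \<open>simp add: files_def\<close>)

lemma finite_nodes: "finite (nodes k)" and card_nodes: "card (nodes k) = k + 2"
proof -
  have "card (systematic k) = k"
    by (simp add: systematic_def card_image inj_on_def)
  moreover have "finite (systematic k)" "systematic k \<inter> {Par_a, Par_b} = {}"
    by (auto simp: systematic_def)
  ultimately show "finite (nodes k)" "card (nodes k) = k + 2"
    by (simp_all add: nodes_def card_Un_disjoint)
qed

lemma restrict_eqD: "restrict u A = restrict v A \<Longrightarrow> x \<in> A \<Longrightarrow> u x = v x"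
  by (metis restrict_apply')


section \<open>Repair of parity nodes\<close>

text \<open>Expresses the download of the plain symbols with index in \<open>T\<close> as a matrix
  of linear functionals.\<close>

definition selection_mat :: "nat \<Rightarrow> nat set \<Rightarrow> 'a::field mat" where
  "selection_mat n T = mat_of_rows n (map (unit_vec n) (sorted_list_of_set T))"

lemma dim_selection_mat:
  "dim_row (selection_mat n T) = card T" "dim_col (selection_mat n T) = n"
  by (simp_all add: selection_mat_def)

lemma selection_mat_mult_eqD:
  assumes eq: "selection_mat n T *\<^sub>v u = selection_mat n T *\<^sub>v (v :: 'a::field vec)"
    and uv: "u \<in> carrier_vec n" "v \<in> carrier_vec n" and T: "T \<subseteq> {..<n}" "r \<in> T"
  shows "u $ r = v $ r"
proof -
  have "finite T"
    using T finite_subset by blast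
  then obtain j where j: "j < card T" "sorted_list_of_set T ! j = r"
    using T by (metis in_set_conv_nth length_sorted_list_of_set set_sorted_list_of_set)
  have "r < n"
    using T by auto
  then have "(selection_mat n T *\<^sub>v w) $ j = w $ r" if "w \<in> carrier_vec n" for w :: "'a vec"
    using j that by (simp add: selection_mat_def)
  then show ?thesis
    using eq uv by metis
qed

text \<open>Entry \<open>r\<close> of the failed parity equals, up to the sign of \<open>X\<^sub>1\<close> at \<open>r\<close>, that of the other parity
  plus multiples of those file parts \<open>i\<close> for which \<open>X\<^sub>i\<close> and \<open>X\<^sub>1\<close> have opposite signs at \<open>r\<close>.\<close>

fun parity_repair_entries :: "nat \<Rightarrow> node \<Rightarrow> nat set" where
  "parity_repair_entries k (Sys i) = {r. r < 2 ^ k \<and> bit r (k - i) \<noteq> bit r (k - 1)}"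
| "parity_repair_entries k Par_a = {..<2 ^ k}"
| "parity_repair_entries k Par_b = {..<2 ^ k}"

abbreviation parity_repair :: "nat \<Rightarrow> node \<Rightarrow> 'a::field mat" where
  "parity_repair k n \<equiv> selection_mat (2 ^ k) (parity_repair_entries k n)"

lemma repair_bandwidth_parity_repair:
  assumes k: "k \<ge> 1" and x: "x \<in> {Par_a, Par_b}"
  shows "repair_bandwidth k x (parity_repair k :: node \<Rightarrow> 'a::field mat) = (k + 1) * (2 ^ k div 2)"
proof -
  let ?c = "\<lambda>n. card (parity_repair_entries k n)" and ?h = "(2 :: nat) ^ k div 2"
  have h: "?h + ?h = 2 ^ k"
    using k by (cases k) auto
  define y where "y = (if x = Par_a then Par_b else Par_a)"
  have "nodes k - {x} = insert y (systematic k)" "y \<notin> systematic k" "?c y = 2 ^ k"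
    using x by (auto simp: nodes_def systematic_def y_def)
  then have "repair_bandwidth k x (parity_repair k :: node \<Rightarrow> 'a mat) = 2 ^ k + (\<Sum>n\<in>systematic k. ?c n)"
    by (simp add: repair_bandwidth_def dim_selection_mat) (simp add: systematic_def)
  also have "(\<Sum>n\<in>systematic k. ?c n) = (\<Sum>i\<in>{1..k}. ?c (Sys i))"
    unfolding systematic_def by (subst sum.reindex) (auto simp: inj_on_def)
  \<comment> \<open>Node 1 contributes nothing: the digit \<open>k - 1\<close> never differs from
    itself. Every other systematic node sends half of its symbols.\<close>
  also have "\<dots> = ?c (Sys 1) + (\<Sum>i\<in>{1..k} - {1}. ?c (Sys i))"
    using k by (intro sum.remove) auto
  also have "(\<Sum>i\<in>{1..k} - {1}. ?c (Sys i)) = (\<Sum>i\<in>{1..k} - {1}. ?h)"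
  proof (rule sum.cong)
    fix i
    assume "i \<in> {1..k} - {1}"
    then have "k - i < k" "k - i \<noteq> k - 1"
      by auto
    then show "?c (Sys i) = ?h"
      using card_bit_differ[of "k - i" k "k - 1"] by simp
  qed simp
  also have "2 ^ k + (?c (Sys 1) + \<dots>) = (k + 1) * ?h"
    using h k by (cases k) auto
  finally show ?thesis .
qed

text \<open>At entry \<open>r\<close> the parities satisfy \<open>b = s 1 * a + t\<close>, where
  \<open>t\<close> is known from the download. As \<open>s 1\<close> is its own inverse, the
  equation can be solved for either parity.\<close>

lemma exact_repair_parity_repair:
  assumes k: "k \<ge> 1" and x: "x \<in> {Par_a, Par_b}"
  shows "exact_repair k x (parity_repair k :: node \<Rightarrow> 'a::field mat)"
  unfolding exact_repair_def determines_def
proof (intro conjI ballI impI)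
  fix n
  show "dim_col (parity_repair k n :: 'a mat) = 2 ^ k"
    by (simp add: dim_selection_mat)
next
  fix f g :: "'a vec"
  assume obs: "(\<lambda>n\<in>nodes k - {x}. parity_repair k n *\<^sub>v node_content k f n) =
    (\<lambda>n\<in>nodes k - {x}. parity_repair k n *\<^sub>v node_content k g n)"
  have known: "node_content k f n $ r = node_content k g n $ r"
    if "n \<in> nodes k - {x}" "r \<in> parity_repair_entries k n" for n r
  proof (rule selection_mat_mult_eqD[OF restrict_eqD[OF obs that(1)] node_content_carrier node_content_carrier])
    show "parity_repair_entries k n \<subseteq> {..<2 ^ k}"
      by (cases n) auto
  qed (rule that(2))
  show "node_content k f x = node_content k g x"
  proof (rule eq_vecI)
    show "dim_vec (node_content k f x) = dim_vec (node_content k g x)"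
      using node_content_carrier carrier_vecD by metis
  next
    fix r
    assume "r < dim_vec (node_content k g x)"
    then have r: "r < 2 ^ k"
      using node_content_carrier carrier_vecD by metis
    define s :: "nat \<Rightarrow> 'a" where "s i = diag_sign k i r" for i
    define a where "a = (\<lambda>h :: 'a vec. node_content k h Par_a $ r)"
    define b where "b = (\<lambda>h :: 'a vec. node_content k h Par_b $ r)"
    define t where "t = (\<lambda>h :: 'a vec. \<Sum>i\<in>{1..k}. (s i - s 1) * file_part k h i $ r)"
    have s1: "s 1 * s 1 = 1"
      by (simp add: s_def)
    have b_eq: "b h = s 1 * a h + t h" for h
      unfolding a_def b_def t_def node_content_Par_a_index[OF r] node_content_Par_b_index[OF r]
      by (simp add: s_def sum_distrib_left algebra_simps flip: sum.distrib)
    have a_eq: "a h = s 1 * (b h - t h)" for h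
      unfolding b_eq using s1 by (simp flip: mult.assoc)
    \<comment> \<open>A summand vanishes if the signs of \<open>X\<^sub>i\<close> and
      \<open>X\<^sub>1\<close> agree at \<open>r\<close>; otherwise its symbol has been
      downloaded.\<close>
    have "t f = t g"
      unfolding t_def
    proof (rule sum.cong)
      fix i
      assume i: "i \<in> {1..k}"
      show "(s i - s 1) * file_part k f i $ r = (s i - s 1) * file_part k g i $ r"
      proof (cases "bit r (k - i) = bit r (k - 1)")
        case True
        then show ?thesis
          by (simp add: s_def diag_sign_def)
      next
        case False
        then show ?thesis
          using known[of "Sys i" r] i r x by (auto simp: nodes_def systematic_def)
      qed
    qed simp
    moreover have "x = Par_a \<Longrightarrow> b f = b g" "x = Par_b \<Longrightarrow> a f = a g"
      using known[of Par_b r] known[of Par_a r] r by (auto simp: a_def b_def nodes_def)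
    ultimately have "x = Par_a \<Longrightarrow> a f = a g" "x = Par_b \<Longrightarrow> b f = b g"
      using a_eq b_eq by metis+
    then show "node_content k f x $ r = node_content k g x $ r"
      using x by (auto simp: a_def b_def)
  qed
qed


section \<open>Failure tolerance\<close>

text \<open>If one systematic node is lost, at most one parity is lost with it. The other parity
  yields the missing part entrywise after subtraction of the known parts, as its coefficient is 1 or
  -1.\<close>

lemma tolerates_card_le_2:
  assumes F: "F \<subseteq> nodes k" "card F \<le> 2" "card (F \<inter> systematic k) \<le> 1"
  shows "tolerates TYPE('a::field) k F"
  unfolding tolerates_def determines_def
proof (intro ballI impI)
  fix f g :: "'a vec"
  assume f: "f \<in> files TYPE('a) k" and g: "g \<in> files TYPE('a) k"
    and obs: "restrict (node_content k f) (nodes k - F) = restrict (node_content k g) (nodes k - F)"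
  have known: "node_content k f n = node_content k g n" if "n \<in> nodes k - F" for n
    using restrict_eqD[OF obs that] .
  have finF: "finite F"
    using F finite_nodes finite_subset by blast
  have sys: "file_part k f j = file_part k g j" if "j \<in> {1..k}" "Sys j \<notin> F" for j
    using known[of "Sys j"] that by (auto simp: nodes_def systematic_def)
  show "f = g"
  proof (cases "F \<inter> systematic k = {}")
    case True
    then have "Sys j \<notin> F" if "j \<in> {1..k}" for j
      using that by (auto simp: systematic_def)
    then have "file_part k f j = file_part k g j" if "j \<in> {1..k}" for j
      using sys that by blast
    then show ?thesis
      by (intro file_eqI[OF f g]) auto
  next
    case False
    then obtain i where i: "i \<in> {1..k}" "Sys i \<in> F"
      unfolding systematic_def by blast
    have only: "Sys j \<notin> F" if "j \<in> {1..k}" "j \<noteq> i" for j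
    proof
      assume "Sys j \<in> F"
      then have "card {Sys i, Sys j} \<le> card (F \<inter> systematic k)"
        using i that finF by (intro card_mono) (auto simp: systematic_def)
      then show False
        using F that by simp
    qed
    have "\<not> {Par_a, Par_b, Sys i} \<subseteq> F"
      using card_mono[OF finF, of "{Par_a, Par_b, Sys i}"] F by auto
    then have par: "Par_a \<notin> F \<or> Par_b \<notin> F"
      using i by auto
    have "file_part k f j $ r = file_part k g j $ r" if j: "j \<in> {1..k}" and r: "r < 2 ^ k" for j r
    proof (cases "j = i")
      case False
      then show ?thesis
        using sys[OF j only[OF j]] by simp
    next
      case True
      \<comment> \<open>The coefficients are left arbitrary to serve both parities: constantly 1 for
        \<open>Par_a\<close>, the signs for \<open>Par_b\<close>.\<close>
      have rest: "(\<Sum>l\<in>{1..k} - {i}. c l * file_part k f l $ r) =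
          (\<Sum>l\<in>{1..k} - {i}. c l * file_part k g l $ r)" for c :: "nat \<Rightarrow> 'a"
        using sys only by (intro sum.cong) auto
      from par show ?thesis
      proof
        assume "Par_a \<notin> F"
        then have "node_content k f Par_a $ r = node_content k g Par_a $ r"
          using known[of Par_a] by (simp add: nodes_def)
        then show ?thesis
          using rest[of "\<lambda>_. 1"] i True
          by (simp only: node_content_Par_a_index[OF r] sum.remove[of "{1..k}" i] finite_atLeastAtMost) simp
      next
        assume "Par_b \<notin> F"
        then have "node_content k f Par_b $ r = node_content k g Par_b $ r"
          using known[of Par_b] by (simp add: nodes_def)
        then have "diag_sign k i r * file_part k f i $ r = diag_sign k i r * file_part k g i $ r"
          using rest[of "\<lambda>l. diag_sign k l r"] i
          by (simp only: node_content_Par_b_index[OF r] sum.remove[of "{1..k}" i] finite_atLeastAtMost) simp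
        then show ?thesis
          using True by (simp add: diag_sign_def split: if_splits)
      qed
    qed
    then show ?thesis
      by (rule file_eqI[OF f g])
  qed
qed


section \<open>Reconstruction of the file\<close>

text \<open>Where \<open>X\<^sub>i\<close> and \<open>X\<^sub>j\<close> have opposite signs, the two parities yield both the sum and the difference of
  the file parts \<open>i\<close> and \<open>j\<close>; elsewhere they only yield the sum.\<close>

lemma reconstruct_two_systematic:
  assumes char: "(1 :: 'a::field) \<noteq> - 1"
    and ij: "i \<in> {1..k}" "j \<in> {1..k}" "i \<noteq> j"
    and f: "f \<in> files TYPE('a) k" and g: "g \<in> files TYPE('a) k"
    and known: "\<And>n. n \<in> nodes k - {Sys i, Sys j} \<Longrightarrow> node_content k f n = node_content k g n"
    and extra: "\<And>r. r < 2 ^ k \<Longrightarrow> bit r (k - i) = bit r (k - j) \<Longrightarrow>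
      file_part k f i $ r = file_part k g i $ r"
  shows "f = g"
proof (rule file_eqI[OF f g])
  fix l r
  assume l: "l \<in> {1..k}" and r: "r < (2 :: nat) ^ k"
  \<comment> \<open>By linearity it suffices to show that the difference of the two files vanishes;
    equal node contents become zero equations for it.\<close>
  let ?d = "\<lambda>l. file_part k f l $ r - file_part k g l $ r"
  have sys: "?d l = 0" if "l \<in> {1..k}" "l \<noteq> i" "l \<noteq> j" for l
    using known[of "Sys l"] that by (auto simp: nodes_def systematic_def)
  have split: "(\<Sum>l\<in>{1..k}. c l * ?d l) = c i * ?d i + c j * ?d j" for c
  proof -
    have "(\<Sum>l\<in>{1..k}. c l * ?d l) = (\<Sum>l\<in>{i, j}. c l * ?d l)"
      using ij sys by (intro sum.mono_neutral_right) auto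
    then show ?thesis
      using ij by simp
  qed
  \<comment> \<open>The factor 1 gives the first sum the shape required by
    \<open>split\<close>.\<close>
  have "(\<Sum>l\<in>{1..k}. 1 * ?d l) = 0" "(\<Sum>l\<in>{1..k}. diag_sign k l r * ?d l) = 0"
    using known[of Par_a] known[of Par_b] node_content_Par_a_index[OF r, of f]
      node_content_Par_a_index[OF r, of g] node_content_Par_b_index[OF r, of f]
      node_content_Par_b_index[OF r, of g]
    by (simp_all add: nodes_def systematic_def right_diff_distrib sum_subtractf)
  then have sum: "?d i + ?d j = 0" and signed: "diag_sign k i r * ?d i + diag_sign k j r * ?d j = 0"
    unfolding split by simp_all
  have "?d i = 0"
  proof (cases "bit r (k - i) = bit r (k - j)")
    case True
    then show ?thesis
      using extra[OF r] by simp
  next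
    case False
    then have "?d i - ?d j = 0"
      using signed by (auto simp: diag_sign_def algebra_simps split: if_splits)
    then have "?d i + ?d i = 0"
      using sum by (metis eq_iff_diff_eq_0)
    then show ?thesis
      by (rule double_eq_0_imp_eq_0[OF char])
  qed
  with sum have "?d i = 0" "?d j = 0"
    by simp_all
  with sys[OF l] have "?d l = 0"
    by (cases "l = i"; cases "l = j") auto
  then show "file_part k f l $ r = file_part k g l $ r"
    by simp
qed

text \<open>If a parity is among the two nodes outside \<open>S\<close>, failure tolerance already
  gives the file with \<open>E\<close> empty. Otherwise two systematic nodes are missing and symbols
  of one of them are added.\<close>

lemma reconstruction:
  assumes char: "(1 :: 'a::field) \<noteq> - 1" and S: "S \<subseteq> nodes k" "card S = k"
  shows "\<exists>E \<subseteq> (nodes k - S) \<times> {..<2 ^ k}. card E \<le> 2 ^ k div 2 \<and>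
    determines k
      (\<lambda>f :: 'a vec. (\<lambda>n \<in> S. node_content k f n, \<lambda>(n, r) \<in> E. node_content k f n $ r))
      (\<lambda>f. f)"
proof -
  have "finite S"
    using S finite_nodes finite_subset by blast
  then have two: "card (nodes k - S) = 2"
    using S by (simp add: card_Diff_subset card_nodes)
  show ?thesis
  proof (cases "card ((nodes k - S) \<inter> systematic k) \<le> 1")
    case True
    with two have "tolerates TYPE('a) k (nodes k - S)"
      by (intro tolerates_card_le_2) auto
    moreover have "nodes k - (nodes k - S) = S"
      using S by auto
    ultimately show ?thesis
      by (intro exI[of _ "{}"]) (simp add: tolerates_def determines_def)
  next
    case False
    from two obtain x y where xy: "nodes k - S = {x, y}" "x \<noteq> y"
      by (auto simp: card_2_iff)
    have fin: "finite (nodes k - S)"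
      using finite_nodes by simp
    have "(nodes k - S) \<inter> systematic k = nodes k - S"
      by (rule card_subset_eq[OF fin]) (use False two card_mono[OF fin, of "(nodes k - S) \<inter> systematic k"] in auto)
    with xy have "x \<in> systematic k" "y \<in> systematic k"
      by auto
    then obtain i j where x: "x = Sys i" and y: "y = Sys j" and ij: "i \<in> {1..k}" "j \<in> {1..k}"
      by (auto simp: systematic_def simp del: atLeastAtMost_iff)
    have neq: "i \<noteq> j"
      using xy x y by auto
    \<comment> \<open>These are the entries at which the two parities give the same equation up to
      sign; there are half of \<open>2 ^ k\<close> of them because the digits \<open>k - i\<close>
      and \<open>k - j\<close> are distinct.\<close>
    define E where "E = {Sys i} \<times> {r :: nat. r < 2 ^ k \<and> bit r (k - i) = bit r (k - j)}"
    have "k - i < k" "k - i \<noteq> k - j"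
      using ij neq by auto
    then have "card E = 2 ^ k div 2"
      by (simp add: E_def card_cartesian_product card_bit_agree)
    moreover have "E \<subseteq> (nodes k - S) \<times> {..<2 ^ k}"
      unfolding xy by (auto simp: E_def x)
    moreover have "f = g"
      if "f \<in> files TYPE('a) k" "g \<in> files TYPE('a) k"
        and obs: "restrict (node_content k f) S = restrict (node_content k g) S"
          "(\<lambda>(n, r) \<in> E. node_content k f n $ r) = (\<lambda>(n, r) \<in> E. node_content k g n $ r)" for f g
    proof (rule reconstruct_two_systematic[OF char ij neq that(1,2)])
      fix n
      assume "n \<in> nodes k - {Sys i, Sys j}"
      then have "n \<in> S"
        using xy x y by auto
      then show "node_content k f n = node_content k g n"
        by (rule restrict_eqD[OF obs(1)])
    next
      fix r :: nat
      assume "r < 2 ^ k" "bit r (k - i) = bit r (k - j)"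
      then have "(Sys i, r) \<in> E"
        by (simp add: E_def)
      from restrict_eqD[OF obs(2) this] show "file_part k f i $ r = file_part k g i $ r"
        by simp
    qed
    ultimately show ?thesis
      by (intro exI[of _ E]) (simp add: determines_def)
  qed
qed

theorem theorem1:
  fixes k :: nat
  assumes "card (UNIV :: 'a::field set) = 3" and "k \<ge> 1"
  shows
    "(\<forall>i \<in> {1..k}.
        (\<exists>Va Vb :: 'a mat. admissible k i Va Vb \<and> sys_bandwidth k i Va Vb = (k + 1) * (2 ^ k div 2)) \<and>
        (\<forall>Va Vb :: 'a mat. admissible k i Va Vb \<longrightarrow> (k + 1) * (2 ^ k div 2) \<le> sys_bandwidth k i Va Vb)) \<and>
     (\<forall>x \<in> {Par_a, Par_b}. \<exists>D :: node \<Rightarrow> 'a mat.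
        exact_repair k x D \<and> repair_bandwidth k x D \<le> (k + 1) * (2 ^ k div 2)) \<and>
     (\<forall>x \<in> nodes k. tolerates TYPE('a) k {x}) \<and>
     (\<forall>F \<subseteq> nodes k. card F = 2 \<and> card (F \<inter> systematic k) \<le> 1 \<longrightarrow> tolerates TYPE('a) k F) \<and>
     (\<forall>S \<subseteq> nodes k. card S = k \<longrightarrow>
        (\<exists>E \<subseteq> (nodes k - S) \<times> {..<2 ^ k}. card E \<le> 2 ^ k div 2 \<and>
           determines k
             (\<lambda>f :: 'a vec. (\<lambda>n \<in> S. node_content k f n, \<lambda>(n, r) \<in> E. node_content k f n $ r))
             (\<lambda>f. f)))"
proof (intro conjI ballI allI impI)
  have char: "(1 :: 'a) \<noteq> - 1"
    using card_3_one_neq_minus_one[OF assms(1)] .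
  {
    fix i
    assume i: "i \<in> {1..k}"
    note adm = admissible_repair_mat[OF char assms(2) i]
    show "\<exists>Va Vb :: 'a mat. admissible k i Va Vb \<and> sys_bandwidth k i Va Vb = (k + 1) * (2 ^ k div 2)"
      using adm sys_bandwidth_ge[OF assms(2) i adm] sys_bandwidth_repair_mat_le[OF assms(2) i]
      by (metis le_antisym)
    show "(k + 1) * (2 ^ k div 2) \<le> sys_bandwidth k i Va Vb" if "admissible k i Va Vb" for Va Vb :: "'a mat"
      by (rule sys_bandwidth_ge[OF assms(2) i that])
  }
  show "\<exists>D :: node \<Rightarrow> 'a mat. exact_repair k x D \<and> repair_bandwidth k x D \<le> (k + 1) * (2 ^ k div 2)"
    if "x \<in> {Par_a, Par_b}" for x
    using exact_repair_parity_repair[OF assms(2) that] repair_bandwidth_parity_repair[OF assms(2) that]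
    by (metis order_refl)
  \<comment> \<open>A single node is covered by the same lemma as the pairs, since it contains at
    most one systematic node.\<close>
  show "tolerates TYPE('a) k {x}" if "x \<in> nodes k" for x
    using that card_mono[of "{x}" "{x} \<inter> systematic k"] by (intro tolerates_card_le_2) auto
  show "tolerates TYPE('a) k F" if "F \<subseteq> nodes k" "card F = 2 \<and> card (F \<inter> systematic k) \<le> 1" for F
    using that by (intro tolerates_card_le_2) auto
  show "\<exists>E \<subseteq> (nodes k - S) \<times> {..<2 ^ k}. card E \<le> 2 ^ k div 2 \<and>
      determines k
        (\<lambda>f :: 'a vec. (\<lambda>n \<in> S. node_content k f n, \<lambda>(n, r) \<in> E. node_content k f n $ r))
        (\<lambda>f. f)" if "S \<subseteq> nodes k" "card S = k" for S
    by (rule reconstruction[OF char that])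
qed

end
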